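(* Let $\Lambda \subseteq \mathbb{R}^n$ be a lattice and let $\Vert \cdot \Vert$ be a strictly convex and smooth norm on $\mathbb{R}^n$. Then the Voronoi cell $\mathcal{V}(\Lambda, \Vert \cdot \Vert)$ is equal to $$\tilde{\mathcal{V}}(\Lambda, \Vert \cdot \Vert) := \{ x \in \mathbb{R}^n \mid \Vert x \Vert \leq \Vert x-v \Vert \text{ for all } v \in \Lambda \text{ that are Voronoi-relevant with respect to } \Vert \cdot \Vert \}.$$ If $n = 2$, the same conclusion holds for every strictly convex norm, without assuming smoothness.
   Context: A lattice $\Lambda \subseteq \mathbb{R}^n$ is a discrete additive subgroup of $\mathbb{R}^n$; all lattices are assumed to have full rank $n$, i.e. $\Lambda$ spans $\mathbb{R}^n$ over $\mathbb{R}$. The Voronoi cell is $\mathcal{V}(\Lambda, \Vert \cdot \Vert) := \{ x \in \mathbb{R}^n \mid \forall v \in \Lambda: \Vert x \Vert \leq \Vert x-v \Vert \}$. A vector $v \in \Lambda \setminus \{0\}$ is Voronoi-relevant (with respect to $\Vert\cdot\Vert$) if there is some $x \in \mathbb{R}^n$ such that $\Vert x \Vert = \Vert x-v \Vert < \Vert x-w \Vert$ for all $w \in \Lambda \setminus \{0,v\}$. A norm is strictly convex if for all distinct $x,y \in \mathbb{R}^n$ with $\Vert x \Vert = \Vert y \Vert$ and all $\tau \in (0,1)$ we have $\Vert \tau x + (1-\tau) y \Vert < \Vert x \Vert$. A norm is smooth if each boundary point $p$ of its closed unit ball $K$ has a unique supporting hyperplane, i.e. a unique hyperplane $H$ through $p$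 such that $K$ is contained in one of the two closed halfspaces bounded by $H$. *)

theory Defs
  imports "HOL-Analysis.Analysis"
begin

text \<open>
  The norm is an explicit function \<open>N\<close>, independent of the Euclidean norm of the type
  \<open>real ^ 'n\<close>. Topological notions (discreteness, boundary) refer to the usual topology of the type.
\<close>

definition norm_on_space :: "(real ^ 'n \<Rightarrow> real) \<Rightarrow> bool" where
  "norm_on_space N \<longleftrightarrow>
     (\<forall>x. 0 \<le> N x) \<and>
     (\<forall>x. N x = 0 \<longleftrightarrow> x = 0) \<and>
     (\<forall>c x. N (c *\<^sub>R x) = \<bar>c\<bar> * N x) \<and>
     (\<forall>x y. N (x + y) \<le> N x + N y)"

definition strictly_convex_norm :: "(real ^ 'n \<Rightarrow> real) \<Rightarrow> bool" where
  "strictly_convex_norm N \<longleftrightarrow>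
     norm_on_space N \<and>
     (\<forall>x y. x \<noteq> y \<and> N x = N y \<longrightarrow>
        (\<forall>t\<in>{0<..<1}. N (t *\<^sub>R x + (1 - t) *\<^sub>R y) < N x))"

definition supporting_hyperplane_at ::
    "(real ^ 'n) set \<Rightarrow> real ^ 'n \<Rightarrow> (real ^ 'n) set \<Rightarrow> bool" where
  "supporting_hyperplane_at K p H \<longleftrightarrow>
     p \<in> H \<and>
     (\<exists>a b. a \<noteq> 0 \<and> H = {x. a \<bullet> x = b} \<and>
        (K \<subseteq> {x. a \<bullet> x \<le> b} \<or> K \<subseteq> {x. a \<bullet> x \<ge> b}))"

text \<open>Uniqueness is of the hyperplane as a point set, not of its normal vector.\<close>

definition smooth_norm :: "(real ^ 'n \<Rightarrow> real) \<Rightarrow> bool" where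
  "smooth_norm N \<longleftrightarrow>
     norm_on_space N \<and>
     (\<forall>p\<in>frontier {x. N x \<le> 1}. \<exists>!H. supporting_hyperplane_at {x. N x \<le> 1} p H)"

definition full_rank_lattice :: "(real ^ 'n) set \<Rightarrow> bool" where
  "full_rank_lattice L \<longleftrightarrow>
     0 \<in> L \<and> (\<forall>u\<in>L. \<forall>v\<in>L. u + v \<in> L) \<and> (\<forall>v\<in>L. - v \<in> L) \<and>
     discrete L \<and> span L = UNIV"

definition voronoi_cell :: "(real ^ 'n) set \<Rightarrow> (real ^ 'n \<Rightarrow> real) \<Rightarrow> (real ^ 'n) set" where
  "voronoi_cell L N = {x. \<forall>v\<in>L. N x \<le> N (x - v)}"

definition voronoi_relevant ::
    "(real ^ 'n) set \<Rightarrow> (real ^ 'n \<Rightarrow> real) \<Rightarrow> real ^ 'n \<Rightarrow> bool" where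
  "voronoi_relevant L N v \<longleftrightarrow>
     v \<in> L - {0} \<and>
     (\<exists>x. N x = N (x - v) \<and> (\<forall>w\<in>L - {0, v}. N (x - v) < N (x - w)))"

definition relevant_voronoi_cell ::
    "(real ^ 'n) set \<Rightarrow> (real ^ 'n \<Rightarrow> real) \<Rightarrow> (real ^ 'n) set" where
  "relevant_voronoi_cell L N = {x. \<forall>v\<in>L. voronoi_relevant L N v \<longrightarrow> N x \<le> N (x - v)}"

end

theory Submission
  imports Defs
begin

text \<open>
  By strict convexity every set \<open>{x. N x \<le> N (x - v)}\<close> is strictly star-shaped about 0.
  So if \<open>x\<close> satisfies all relevant inequalities but lies outside the cell, then the segment from 0
  to \<open>x\<close> leaves the cell at a point \<open>y\<close> where no active vector \<open>v\<close>, i.e. one with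
  \<open>N y = N (y - v)\<close>, is relevant. To refute this, linearise at \<open>y\<close> by one-sided directional
  derivatives and leave the linearised cell along a line \<open>h + s y\<close>. If no point of the line lies on
  two linearised bisectors, then it leaves through exactly one of them, and that active vector is
  relevant. A suitable \<open>h\<close> exists because subgradients of \<open>N\<close> at three distinct points of an
  \<open>N\<close>-sphere are not collinear: for smooth \<open>N\<close> the subgradients at \<open>y\<close> and at the points \<open>y - v\<close>
  are unique, so only finitely many hyperplanes have to be avoided; in the plane a vector on two
  linearised bisectors would be orthogonal to two independent differences of subgradients, so any
  \<open>h\<close> not parallel to \<open>y\<close> will do.
\<close>

section \<open>Norms on Euclidean space and finiteness of lattice balls\<close>

locale norm_space =
  fixes N :: "real ^ 'n \<Rightarrow> real"
  assumes norm_on_space: "norm_on_space N"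
begin

lemma N_nonneg [simp]: "0 \<le> N x"
  and N_eq_0_iff [simp]: "N x = 0 \<longleftrightarrow> x = 0"
  and N_scaleR: "N (c *\<^sub>R x) = \<bar>c\<bar> * N x"
  and N_triangle: "N (x + y) \<le> N x + N y"
  using norm_on_space by (auto simp: norm_on_space_def)

lemma N_zero [simp]: "N 0 = 0"
  by simp

lemma N_pos: "x \<noteq> 0 \<Longrightarrow> 0 < N x"
  using N_nonneg[of x] N_eq_0_iff[of x] by linarith

lemma N_minus: "N (- x) = N x"
  using N_scaleR[of "-1" x] by simp

lemma N_minus_commute: "N (x - y) = N (y - x)"
  using N_minus[of "x - y"] by simp

lemma N_diff_le: "N x - N y \<le> N (x - y)"
  using N_triangle[of "x - y" y] by simp

lemma convex_on_N: "convex_on UNIV N"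
proof (rule convex_onI)
  fix t :: real and x y assume "0 < t" "t < 1"
  then show "N ((1 - t) *\<^sub>R x + t *\<^sub>R y) \<le> (1 - t) * N x + t * N y"
    using N_triangle[of "(1 - t) *\<^sub>R x" "t *\<^sub>R y"] by (simp add: N_scaleR)
qed simp

lemma continuous_on_N [continuous_intros]:
  "continuous_on S f \<Longrightarrow> continuous_on S (\<lambda>x. N (f x))"
  using continuous_on_compose2[OF convex_on_continuous[OF open_UNIV convex_on_N]] by blast

lemma tendsto_N [tendsto_intros]: "(f \<longlongrightarrow> l) F \<Longrightarrow> ((\<lambda>x. N (f x)) \<longlongrightarrow> N l) F"
  using continuous_on_N[OF continuous_on_id, of UNIV]
  by (simp add: continuous_on_eq_continuous_at continuous_at isCont_tendsto_compose)

lemma N_bounds: obtains m M where "0 < m" "\<And>x. m * norm x \<le> N x" "\<And>x. N x \<le> M * norm x"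
proof -
  have c: "compact (sphere (0::real^'n) 1)" "sphere (0::real^'n) 1 \<noteq> {}" by auto
  obtain a where a: "a \<in> sphere 0 1" "\<And>x. x \<in> sphere 0 1 \<Longrightarrow> N a \<le> N x"
    using continuous_attains_inf[OF c continuous_on_N[OF continuous_on_id]] by auto
  obtain b where b: "b \<in> sphere 0 1" "\<And>x. x \<in> sphere 0 1 \<Longrightarrow> N x \<le> N b"
    using continuous_attains_sup[OF c continuous_on_N[OF continuous_on_id]] by auto
  have eq: "N x = norm x * N (x /\<^sub>R norm x)" for x
    by (cases "x = 0") (auto simp: N_scaleR)
  have "0 < N a" using a(1) by (intro N_pos) auto
  moreover have "N a * norm x \<le> N x" "N x \<le> N b * norm x" for x
    using a(2)[of "x /\<^sub>R norm x"] b(2)[of "x /\<^sub>R norm x"] eq[of x]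
    by (cases "x = 0"; simp add: mult.commute mult_left_mono)+
  ultimately show thesis using that by blast
qed

text \<open>Subtracting lattice points turns isolation of 0 into uniform discreteness, and
  comparison with the Euclidean norm makes the \<open>N\<close>-ball bounded.\<close>

lemma finite_lattice_ball:
  assumes "full_rank_lattice L"
  shows "finite {v \<in> L. N v \<le> c}"
proof -
  obtain m where m: "0 < m" "\<And>x. m * norm x \<le> N x" using N_bounds by metis
  have L: "0 \<in> L" "\<And>u v. u \<in> L \<Longrightarrow> v \<in> L \<Longrightarrow> u - v \<in> L" "discrete L"
    using assms unfolding full_rank_lattice_def
    by (auto simp: diff_conv_add_uminus simp del: add_uminus_conv_diff)
  obtain e where e: "e > 0" "\<And>v. v \<in> L \<Longrightarrow> dist 0 v < e \<Longrightarrow> v = 0"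
    using L(1,3) unfolding discrete_def isolated_in_dist_Ex_iff by blast
  have "uniform_discrete L"
    unfolding uniform_discrete_def
  proof (intro exI[of _ e] conjI ballI impI)
    fix u v assume "u \<in> L" "v \<in> L" "dist u v < e"
    then show "u = v" using e(2)[of "u - v"] L(2) by (simp add: dist_norm norm_minus_commute)
  qed fact
  then have "uniform_discrete {v \<in> L. N v \<le> c}" by (rule uniform_discrete_subset) auto
  moreover have "bounded {v \<in> L. N v \<le> c}"
  proof (rule boundedI)
    fix v assume "v \<in> {v \<in> L. N v \<le> c}"
    then show "norm v \<le> c / m" using m(1) m(2)[of v] by (simp add: field_simps)
  qed
  ultimately show ?thesis by (simp add: uniform_discrete_finite_iff[symmetric])
qed

text \<open>The triangle inequality forces \<open>N v \<le> 2 * N y\<close>. Thus only finitely many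
  bisectors matter at a given point.\<close>

lemma finite_closer:
  assumes "\<And>c. finite {v \<in> L. N v \<le> c}"
  shows "finite {v \<in> L. N (y - v) \<le> N y}"
proof (rule finite_subset[OF _ assms])
  show "{v \<in> L. N (y - v) \<le> N y} \<subseteq> {v \<in> L. N v \<le> 2 * N y}"
  proof
    fix v assume "v \<in> {v \<in> L. N (y - v) \<le> N y}"
    then show "v \<in> {v \<in> L. N v \<le> 2 * N y}"
      using N_diff_le[of v y] by (simp add: N_minus_commute)
  qed
qed

section \<open>Subgradients of the norm\<close>

text \<open>By homogeneity the two conditions together amount to the usual subgradient inequality
  \<open>N p + g \<bullet> (x - p) \<le> N x\<close>.\<close>

definition subgrad :: "real ^ 'n \<Rightarrow> real ^ 'n \<Rightarrow> bool" where
  "subgrad p g \<longleftrightarrow> g \<bullet> p = N p \<and> (\<forall>x. g \<bullet> x \<le> N x)"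

lemma subgrad_le: "subgrad p g \<Longrightarrow> g \<bullet> x \<le> N x"
  and subgrad_eq: "subgrad p g \<Longrightarrow> g \<bullet> p = N p"
  by (auto simp: subgrad_def)

text \<open>A hyperplane separates \<open>p\<close> from the open ball of radius \<open>N p\<close>;
  rescaling its normal gives the subgradient.\<close>

lemma subgrad_exists: "\<exists>g. subgrad p g"
proof (cases "p = 0")
  case True
  then show ?thesis by (intro exI[of _ 0]) (simp add: subgrad_def)
next
  case False
  have "convex {x. N x < N p}"
  proof (rule convexI)
    fix x y and u v :: real
    assume "x \<in> {x. N x < N p}" "y \<in> {x. N x < N p}" and uv: "0 \<le> u" "0 \<le> v" "u + v = 1"
    then have xy: "N x < N p" "N y < N p" by auto
    have "u * N x + v * N y < N p" using convex_bound_lt[OF xy uv] .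
    then show "u *\<^sub>R x + v *\<^sub>R y \<in> {x. N x < N p}"
      using N_triangle[of "u *\<^sub>R x" "v *\<^sub>R y"] uv by (simp add: N_scaleR)
  qed
  then obtain a where a: "a \<noteq> 0" "\<And>x. N x < N p \<Longrightarrow> a \<bullet> x \<le> a \<bullet> p"
    using separating_hyperplane_sets[of "{x. N x < N p}" "{p}"] N_pos[OF False]
    by (auto intro!: exI[of _ 0]) (metis N_eq_0_iff order_trans)
  have le: "(a \<bullet> x) * N p \<le> N x * (a \<bullet> p)" for x
  proof -
    \<comment> \<open>Separation speaks only of the open ball, so \<open>x\<close> is scaled
      strictly inside it with some \<open>u > N x\<close>; then \<open>u\<close> decreases to
      \<open>N x\<close>.\<close>
    have "(a \<bullet> x) * N p \<le> u * (a \<bullet> p)" if "u > N x" for u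
    proof -
      have "u > 0" using that N_nonneg[of x] by linarith
      then have "N ((N p / u) *\<^sub>R x) < N p"
        using that N_pos[OF False] by (simp add: N_scaleR field_simps)
      then show ?thesis using a(2) \<open>u > 0\<close> by (fastforce simp: field_simps)
    qed
    then have "eventually (\<lambda>u. (a \<bullet> x) * N p \<le> u * (a \<bullet> p)) (at_right (N x))"
      by (auto simp: eventually_at_right_less eventually_at_filter)
    moreover have "((\<lambda>u. u * (a \<bullet> p)) \<longlongrightarrow> N x * (a \<bullet> p)) (at_right (N x))"
      by (intro tendsto_intros)
    ultimately show ?thesis
      by (intro tendsto_lowerbound[where F = "at_right (N x)"]) simp_all
  qed
  have "0 < (a \<bullet> a) * N p" using a(1) N_pos[OF False] by simp
  then have "0 < a \<bullet> p" using le[of a] N_pos[OF a(1)] by (meson less_le_trans zero_less_mult_pos)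
  then have "subgrad p ((N p / (a \<bullet> p)) *\<^sub>R a)"
    using le by (auto simp: subgrad_def field_simps)
  then show ?thesis by blast
qed

text \<open>A subgradient at \<open>p\<close> is the normal of a hyperplane supporting the unit ball
  at \<open>p /\<^sub>R N p\<close>, normalised to level 1. With this normalisation the hyperplane
  determines the vector.\<close>

lemma smooth_subgrad_unique:
  assumes "smooth_norm N" "p \<noteq> 0" "subgrad p g" "subgrad p g'"
  shows "g = g'"
proof -
  define q where "q = p /\<^sub>R N p"
  have q: "N q = 1" "g \<bullet> q = 1" "g' \<bullet> q = 1"
    using assms(2-4) by (simp_all add: q_def N_scaleR subgrad_def)
  let ?K = "{x. N x \<le> 1}"
  have "q \<in> frontier ?K"
  proof -
    have "q \<notin> interior ?K"
    proof
      assume "q \<in> interior ?K"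
      then obtain e where e: "e > 0" "ball q e \<subseteq> ?K" by (auto simp: mem_interior)
      have "q \<noteq> 0" using q(1) by auto
      \<comment> \<open>Stretching \<open>q\<close> by \<open>1 + d\<close> moves it by
        \<open>e / 2\<close>, so it stays in the Euclidean ball but leaves the unit ball of
        \<open>N\<close>.\<close>
      define d where "d = e / (2 * norm q)"
      have "d > 0" using e \<open>q \<noteq> 0\<close> by (simp add: d_def)
      have "(1 + d) *\<^sub>R q \<in> ball q e"
        using \<open>d > 0\<close> e(1) \<open>q \<noteq> 0\<close> by (simp add: dist_norm algebra_simps d_def)
      then have "N ((1 + d) *\<^sub>R q) \<le> 1" using e by blast
      then show False using \<open>d > 0\<close> q by (simp add: N_scaleR)
    qed
    moreover have "q \<in> closure ?K" using q closure_subset[of ?K] by auto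
    ultimately show ?thesis by (simp add: frontier_def)
  qed
  moreover have "supporting_hyperplane_at ?K q {x. u \<bullet> x = 1}"
    if "subgrad p u" "u \<bullet> q = 1" for u
  proof -
    have "u \<noteq> 0" using that(2) by auto
    moreover have "?K \<subseteq> {x. u \<bullet> x \<le> 1}" using subgrad_le[OF that(1)] order_trans by auto
    ultimately show ?thesis using that(2) unfolding supporting_hyperplane_at_def by blast
  qed
  ultimately have H: "{x. g \<bullet> x = 1} = {x. g' \<bullet> x = 1}"
    using assms(1,3,4) q(2,3) unfolding smooth_norm_def by blast
  have "g \<bullet> x = g' \<bullet> x" for x
  proof -
    have "x + (1 - g \<bullet> x) *\<^sub>R q \<in> {x. g \<bullet> x = 1}" using q by (simp add: inner_add_right)
    then have "x + (1 - g \<bullet> x) *\<^sub>R q \<in> {x. g' \<bullet> x = 1}" by (simp only: H)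
    then show ?thesis using q by (simp add: inner_add_right)
  qed
  then show ?thesis by (metis vector_eq_rdot)
qed

section \<open>One-sided directional derivatives\<close>

text \<open>The quotient is monotone in \<open>t\<close> by convexity, so the infimum is the one-sided limit.\<close>

definition dirderiv :: "real ^ 'n \<Rightarrow> real ^ 'n \<Rightarrow> real" where
  "dirderiv p h = (INF t\<in>{0<..}. (N (p + t *\<^sub>R h) - N p) / t)"

lemma quotient_bdd_below: "bdd_below ((\<lambda>t. (N (p + t *\<^sub>R h) - N p) / t) ` {0<..})"
proof -
  obtain g where g: "subgrad p g" using subgrad_exists by blast
  have "g \<bullet> h \<le> (N (p + t *\<^sub>R h) - N p) / t" if "t > 0" for t
    using subgrad_le[OF g, of "p + t *\<^sub>R h"] subgrad_eq[OF g] that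
    by (simp add: inner_add_right field_simps)
  then show ?thesis by (intro bdd_belowI2[of _ "g \<bullet> h"]) auto
qed

lemma dirderiv_le_quotient: "0 < t \<Longrightarrow> dirderiv p h \<le> (N (p + t *\<^sub>R h) - N p) / t"
  unfolding dirderiv_def by (rule cINF_lower[OF quotient_bdd_below]) simp

lemma subgrad_le_dirderiv: assumes "subgrad p g" shows "g \<bullet> h \<le> dirderiv p h"
  unfolding dirderiv_def
proof (rule cINF_greatest)
  fix t :: real assume "t \<in> {0<..}"
  then show "g \<bullet> h \<le> (N (p + t *\<^sub>R h) - N p) / t"
    using subgrad_le[OF assms, of "p + t *\<^sub>R h"] subgrad_eq[OF assms]
    by (simp add: inner_add_right field_simps)
qed auto

lemma quotient_mono:
  assumes "0 < s" "s \<le> t"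
  shows "(N (p + s *\<^sub>R h) - N p) / s \<le> (N (p + t *\<^sub>R h) - N p) / t"
proof -
  have "p + s *\<^sub>R h = (1 - s / t) *\<^sub>R p + (s / t) *\<^sub>R (p + t *\<^sub>R h)"
    using assms by (simp add: algebra_simps)
  then have "N (p + s *\<^sub>R h) \<le> (1 - s / t) * N p + (s / t) * N (p + t *\<^sub>R h)"
    using convex_onD[OF convex_on_N, of "s / t" p "p + t *\<^sub>R h"] assms by simp
  then show ?thesis using assms by (simp add: field_simps)
qed

lemma dirderiv_tendsto:
  "((\<lambda>t. (N (p + t *\<^sub>R h) - N p) / t) \<longlongrightarrow> dirderiv p h) (at_right 0)"
proof (rule order_tendstoI)
  fix a assume "a < dirderiv p h"
  then show "\<forall>\<^sub>F t in at_right 0. a < (N (p + t *\<^sub>R h) - N p) / t"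
    unfolding eventually_at_filter
    by (intro always_eventually) (meson dirderiv_le_quotient greaterThan_iff less_le_trans)
next
  fix a assume "dirderiv p h < a"
  then obtain t where t: "t > 0" "(N (p + t *\<^sub>R h) - N p) / t < a"
    unfolding dirderiv_def using cINF_less_iff[OF _ quotient_bdd_below] by fastforce
  then have "(N (p + s *\<^sub>R h) - N p) / s < a" if "0 < s" "s < t" for s
    using quotient_mono[of s t p h] that by linarith
  then show "\<forall>\<^sub>F t in at_right 0. (N (p + t *\<^sub>R h) - N p) / t < a"
    unfolding eventually_at_right_field using t(1) by blast
qed

text \<open>This is the max formula for directional derivatives: subgradients at points approaching
  \<open>p\<close> along \<open>h\<close> are bounded, and a limit of them is a maximising
  subgradient at \<open>p\<close>.\<close>

lemma dirderiv_attained: obtains g where "subgrad p g" "g \<bullet> h = dirderiv p h"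
proof -
  obtain M where M: "\<And>x. N x \<le> M * norm x" using N_bounds by metis
  define p' where "p' n = p + inverse (real (Suc n)) *\<^sub>R h" for n
  have "\<forall>n. \<exists>g. subgrad (p' n) g" using subgrad_exists by blast
  then obtain g where g: "\<And>n. subgrad (p' n) (g n)" by metis
  have "norm (g n) \<le> \<bar>M\<bar>" for n
  proof -
    have "norm (g n) * norm (g n) \<le> \<bar>M\<bar> * norm (g n)"
      using subgrad_le[OF g, of n "g n"] M[of "g n"] mult_right_mono[OF abs_ge_self, of "norm (g n)" M]
      by (simp add: dot_square_norm power2_eq_square)
    then show ?thesis by (cases "g n = 0") auto
  qed
  then have "\<forall>n. g n \<in> cball 0 \<bar>M\<bar>" by simp
  then obtain l r where r: "strict_mono r" and l: "(g \<circ> r) \<longlonglongrightarrow> l"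
    using compact_cball[of 0 "\<bar>M\<bar>"] unfolding compact_def by blast
  have l': "(\<lambda>n. g (r n)) \<longlonglongrightarrow> l" using l by (simp add: o_def)
  have "(\<lambda>n. p + inverse (real (Suc n)) *\<^sub>R h) \<longlonglongrightarrow> p + 0 *\<^sub>R h"
    by (intro tendsto_intros LIMSEQ_inverse_real_of_nat)
  then have p': "(\<lambda>n. p' (r n)) \<longlonglongrightarrow> p"
    using LIMSEQ_subseq_LIMSEQ[OF _ r] by (fastforce simp: p'_def o_def)
  have "l \<bullet> x \<le> N x" for x
    by (rule LIMSEQ_le_const2[OF tendsto_inner[OF l' tendsto_const]])
       (use subgrad_le[OF g] in blast)
  moreover have "l \<bullet> p = N p"
    using LIMSEQ_unique[OF tendsto_inner[OF l' p']] tendsto_N[OF p'] subgrad_eq[OF g] by simp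
  ultimately have sl: "subgrad p l" by (simp add: subgrad_def)
  \<comment> \<open>By convexity the slope of the chord from \<open>p\<close> to \<open>p' n\<close>
    is at most the slope given by a subgradient at its far end.\<close>
  have "dirderiv p h \<le> g n \<bullet> h" for n
  proof -
    let ?t = "inverse (real (Suc n))"
    have "dirderiv p h \<le> (N (p' n) - N p) / ?t"
      unfolding p'_def by (rule dirderiv_le_quotient) simp
    moreover have "N (p' n) - N p \<le> g n \<bullet> (?t *\<^sub>R h)"
      using subgrad_eq[OF g, of n] subgrad_le[OF g, of n p]
      by (simp add: p'_def inner_add_right)
    ultimately show ?thesis by (simp add: field_simps)
  qed
  then have "dirderiv p h \<le> l \<bullet> h"
    using LIMSEQ_le_const[OF tendsto_inner[OF l' tendsto_const]] by auto
  then have "l \<bullet> h = dirderiv p h" using subgrad_le_dirderiv[OF sl, of h] by linarith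
  with sl show thesis by (rule that)
qed

lemma dirderiv_add_le: "dirderiv p (a + b) \<le> dirderiv p a + dirderiv p b"
proof -
  obtain g where g: "subgrad p g" "g \<bullet> (a + b) = dirderiv p (a + b)"
    by (rule dirderiv_attained)
  then show ?thesis
    using subgrad_le_dirderiv[OF g(1), of a] subgrad_le_dirderiv[OF g(1), of b]
    by (simp add: inner_add_right)
qed

lemma dirderiv_scaleR:
  assumes "0 \<le> c" shows "dirderiv p (c *\<^sub>R a) = c * dirderiv p a"
proof (rule antisym)
  obtain g where g: "subgrad p g" "g \<bullet> (c *\<^sub>R a) = dirderiv p (c *\<^sub>R a)" by (rule dirderiv_attained)
  then show "dirderiv p (c *\<^sub>R a) \<le> c * dirderiv p a"
    using mult_left_mono[OF subgrad_le_dirderiv[OF g(1), of a] assms] by simp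
next
  obtain g where g: "subgrad p g" "g \<bullet> a = dirderiv p a" by (rule dirderiv_attained)
  then show "c * dirderiv p a \<le> dirderiv p (c *\<^sub>R a)"
    using subgrad_le_dirderiv[OF g(1), of "c *\<^sub>R a"] by simp
qed

text \<open>All subgradients at \<open>p\<close> agree on \<open>p\<close>, so this direction
  contributes linearly, for either sign of \<open>s\<close>.\<close>

lemma dirderiv_add_self: "dirderiv p (a + s *\<^sub>R p) = dirderiv p a + s * N p"
proof (rule antisym)
  obtain g where g: "subgrad p g" "g \<bullet> (a + s *\<^sub>R p) = dirderiv p (a + s *\<^sub>R p)" by (rule dirderiv_attained)
  then show "dirderiv p (a + s *\<^sub>R p) \<le> dirderiv p a + s * N p"
    using subgrad_le_dirderiv[OF g(1), of a] subgrad_eq[OF g(1)] by (simp add: inner_add_right)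
next
  obtain g where g: "subgrad p g" "g \<bullet> a = dirderiv p a" by (rule dirderiv_attained)
  then show "dirderiv p a + s * N p \<le> dirderiv p (a + s *\<^sub>R p)"
    using subgrad_le_dirderiv[OF g(1), of "a + s *\<^sub>R p"] subgrad_eq[OF g(1)] by (simp add: inner_add_right)
qed

lemma continuous_on_dirderiv [continuous_intros]:
  assumes "continuous_on S f"
  shows "continuous_on S (\<lambda>x. dirderiv p (f x))"
proof -
  have "convex_on UNIV (dirderiv p)"
  proof (rule convex_onI)
    fix t :: real and x y assume "0 < t" "t < 1"
    then show "dirderiv p ((1 - t) *\<^sub>R x + t *\<^sub>R y) \<le> (1 - t) * dirderiv p x + t * dirderiv p y"
      using dirderiv_add_le[of p "(1 - t) *\<^sub>R x" "t *\<^sub>R y"] by (simp add: dirderiv_scaleR)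
  qed simp
  then have "continuous_on UNIV (dirderiv p)" by (rule convex_on_continuous[OF open_UNIV])
  then show ?thesis using assms by (rule continuous_on_compose2) simp
qed

end

section \<open>Subgradients of a strictly convex norm\<close>

locale strict_norm_space = norm_space N for N :: "real ^ 'n \<Rightarrow> real" +
  assumes strictly_convex: "strictly_convex_norm N"
begin

text \<open>Otherwise \<open>g\<close> would equal \<open>N p\<close> at the midpoint of
  \<open>p\<close> and \<open>q\<close>, where strict convexity makes \<open>N\<close>
  smaller.\<close>

lemma subgrad_less:
  assumes "subgrad p g" "N q = N p" "q \<noteq> p"
  shows "g \<bullet> q < N q"
proof (rule ccontr)
  assume "\<not> g \<bullet> q < N q"
  then have "g \<bullet> q = N p" using subgrad_le[OF assms(1), of q] assms(2) by linarith
  then have "g \<bullet> ((1/2) *\<^sub>R q + (1 - 1/2) *\<^sub>R p) = N p"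
    using subgrad_eq[OF assms(1)] by (simp add: inner_add_right)
  moreover have "1/2 \<in> {0<..<1::real}" by simp
  then have "N ((1/2) *\<^sub>R q + (1 - 1/2) *\<^sub>R p) < N q"
    using strictly_convex assms(2,3) \<open>1/2 \<in> {0<..<1::real}\<close>
    unfolding strictly_convex_norm_def by blast
  ultimately show False
    using subgrad_le[OF assms(1), of "(1/2) *\<^sub>R q + (1 - 1/2) *\<^sub>R p"] assms(2) by linarith
qed

text \<open>Evaluated at \<open>p\<close>, both \<open>ga\<close> and \<open>gb\<close> stay
  strictly below \<open>N p\<close>, while \<open>g\<close> attains it.\<close>

lemma subgrad_not_between:
  assumes "subgrad p g" "subgrad a ga" "subgrad b gb"
    and "N a = N p" "N b = N p" "a \<noteq> p" "b \<noteq> p" and u: "0 \<le> u" "u \<le> 1"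
  shows "g \<noteq> (1 - u) *\<^sub>R ga + u *\<^sub>R gb"
proof
  assume g: "g = (1 - u) *\<^sub>R ga + u *\<^sub>R gb"
  have "ga \<bullet> p < N p" "gb \<bullet> p < N p" using assms subgrad_less by metis+
  then have "(1 - u) * (ga \<bullet> p) + u * (gb \<bullet> p) < N p"
    using u by (intro convex_bound_lt) auto
  then show False using subgrad_eq[OF assms(1)] by (simp add: g inner_add_left)
qed

text \<open>The dual unit sphere need not be strictly convex, but a line meets it in at most two points
  that are subgradients at distinct points of a sphere of \<open>N\<close>.\<close>

lemma subgrad_not_collinear:
  assumes g: "subgrad p g" "subgrad a ga" "subgrad b gb"
    and N: "N a = N p" "N b = N p" and ne: "a \<noteq> p" "b \<noteq> p" "a \<noteq> b"
  shows "ga - g \<noteq> c *\<^sub>R (gb - g)"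
proof
  assume eq: "ga - g = c *\<^sub>R (gb - g)"
  \<comment> \<open>The position of \<open>c\<close> decides which of the three vectors lies between
    the other two: \<open>g\<close>, \<open>ga\<close> or \<open>gb\<close>, respectively.\<close>
  consider "c < 0" | "0 \<le> c" "c \<le> 1" | "1 < c" by linarith
  then show False
  proof cases
    case 1
    define u where "u = - c / (1 - c)"
    have u: "0 \<le> u" "u \<le> 1" "1 - u = 1 / (1 - c)" using 1 by (auto simp: u_def field_simps)
    have "(1 - c) *\<^sub>R g = ga - c *\<^sub>R gb" using eq by (simp add: algebra_simps)
    then have "(1 / (1 - c)) *\<^sub>R (1 - c) *\<^sub>R g = (1 / (1 - c)) *\<^sub>R (ga - c *\<^sub>R gb)"
      by simp
    then have "g = (1 / (1 - c)) *\<^sub>R (ga - c *\<^sub>R gb)" using 1 by simp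
    then have "g = (1 - u) *\<^sub>R ga + u *\<^sub>R gb"
      by (simp only: u(3)) (simp add: u_def scaleR_diff_right)
    then show False using subgrad_not_between[OF g N ne(1,2) u(1,2)] by simp
  next
    case 2
    have "ga = (1 - c) *\<^sub>R g + c *\<^sub>R gb" using eq by (simp add: algebra_simps)
    then show False using subgrad_not_between[OF g(2,1,3) _ _ _ _ 2] N ne by auto
  next
    case 3
    then have "gb - g = (1 / c) *\<^sub>R (ga - g)" using eq by simp
    then have "gb = (1 - 1 / c) *\<^sub>R g + (1 / c) *\<^sub>R ga" by (simp add: algebra_simps)
    then show False using subgrad_not_between[OF g(3,1,2), of "1 / c"] N ne 3 by auto
  qed
qed

section \<open>Bisectors and their linearisation\<close>

text \<open>Apply a subgradient at \<open>x - v\<close> to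
  \<open>x - v = (1 - t) x + (t x - v)\<close>. If the claim failed, this subgradient would also
  attain the norm at \<open>x\<close>, on the same sphere, against strict convexity.\<close>

lemma bisector_star:
  assumes "N x \<le> N (x - v)" "v \<noteq> 0" "0 \<le> t" "t < 1"
  shows "N (t *\<^sub>R x) < N (t *\<^sub>R x - v)"
proof (rule ccontr)
  assume "\<not> ?thesis"
  then have le: "N (t *\<^sub>R x - v) \<le> t * N x" using assms(3) by (simp add: N_scaleR)
  obtain g where g: "subgrad (x - v) g" using subgrad_exists by blast
  have "N (x - v) = (1 - t) * (g \<bullet> x) + g \<bullet> (t *\<^sub>R x - v)"
    using subgrad_eq[OF g] by (simp add: inner_diff_right algebra_simps)
  also have "\<dots> \<le> (1 - t) * (g \<bullet> x) + t * N x"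
    using subgrad_le[OF g, of "t *\<^sub>R x - v"] le by linarith
  finally have *: "N (x - v) \<le> (1 - t) * (g \<bullet> x) + t * N x" .
  then have "(1 - t) * N x \<le> (1 - t) * (g \<bullet> x)" using assms(1) by (simp add: algebra_simps)
  then have "N x \<le> g \<bullet> x" using assms(4) by simp
  then have gx: "g \<bullet> x = N x" using subgrad_le[OF g, of x] by linarith
  then have "N x = N (x - v)" using * assms(1) by (simp add: algebra_simps)
  then show False using subgrad_less[OF g, of x] gx assms(2) by simp
qed

text \<open>No point of the line \<open>h + s y\<close> lies on two of the bisectors \<open>N x = N (x - v)\<close>, \<open>v \<in> F\<close>,
  linearised at \<open>y\<close>.\<close>

definition transversal :: "real ^ 'n \<Rightarrow> (real ^ 'n) set \<Rightarrow> real ^ 'n \<Rightarrow> bool" where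
  "transversal y F h \<longleftrightarrow> (\<forall>v\<in>F. \<forall>w\<in>F. \<forall>s. v \<noteq> w \<longrightarrow>
      dirderiv (y - v) (h + s *\<^sub>R y) = dirderiv y (h + s *\<^sub>R y) \<longrightarrow>
      dirderiv (y - w) (h + s *\<^sub>R y) \<noteq> dirderiv y (h + s *\<^sub>R y))"

text \<open>The direction \<open>h\<close> is tilted by multiples of \<open>y\<close> until it leaves the linearised Voronoi cell
  at \<open>y\<close>; by the hypothesis on \<open>h\<close> it does so through a single bisector, and an intermediate value
  argument transfers this to points of the cell near \<open>y\<close>.\<close>

lemma voronoi_relevant_exists:
  fixes L :: "(real ^ 'n) set" and y :: "real ^ 'n"
  defines "F \<equiv> {v \<in> L - {0}. N (y - v) = N y}"
  assumes fin: "\<And>c. finite {v \<in> L. N v \<le> c}"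
    and y: "y \<in> voronoi_cell L N" "y \<noteq> 0" and ne: "F \<noteq> {}"
    and h: "transversal y F h"
  shows "\<exists>v\<in>F. voronoi_relevant L N v"
proof -
  have finF: "finite F"
    by (rule finite_subset[OF _ finite_closer[OF fin, of y]]) (auto simp: F_def)
  \<comment> \<open>The sign of \<open>\<phi> v s\<close> tells on which side of the linearised
    bisector of \<open>v\<close> the direction \<open>h + s y\<close> lies; positive is the side of
    0. It decreases in \<open>s\<close> at rate at least \<open>\<kappa> v\<close>.\<close>
  define \<phi> where "\<phi> v s = dirderiv (y - v) (h + s *\<^sub>R y) - dirderiv y (h + s *\<^sub>R y)" for v s
  define \<kappa> where "\<kappa> v = N y - dirderiv (y - v) y" for v
  have \<kappa>: "0 < \<kappa> v" if "v \<in> F" for v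
  proof -
    obtain g where "subgrad (y - v) g" "g \<bullet> y = dirderiv (y - v) y" by (rule dirderiv_attained)
    then show ?thesis using that subgrad_less[of "y - v" g y] by (auto simp: F_def \<kappa>_def)
  qed
  have \<phi>_le: "\<phi> v t \<le> \<phi> v s - (t - s) * \<kappa> v" if "s \<le> t" for v s t
  proof -
    have eq: "h + t *\<^sub>R y = (h + s *\<^sub>R y) + (t - s) *\<^sub>R y" by (simp add: algebra_simps)
    have "dirderiv (y - v) (h + t *\<^sub>R y)
      \<le> dirderiv (y - v) (h + s *\<^sub>R y) + (t - s) * dirderiv (y - v) y"
      unfolding eq using dirderiv_add_le[of "y - v" "h + s *\<^sub>R y" "(t - s) *\<^sub>R y"]
      by (simp only: dirderiv_scaleR that diff_ge_0_iff_ge)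
    then show ?thesis by (simp add: \<phi>_def \<kappa>_def dirderiv_add_self algebra_simps)
  qed
  have \<phi>_less: "\<phi> v t < \<phi> v s" if "s < t" "v \<in> F" for v s t
    using \<phi>_le[of s t v] mult_pos_pos[of "t - s" "\<kappa> v"] \<kappa>[OF that(2)] that(1) by linarith
  have "\<exists>s. \<phi> v s = 0" if v: "v \<in> F" for v
  proof -
    define b where "b = \<bar>\<phi> v 0\<bar> / \<kappa> v"
    have b: "0 \<le> b" "b * \<kappa> v = \<bar>\<phi> v 0\<bar>" using \<kappa>[OF v] by (auto simp: b_def)
    have "\<phi> v b \<le> 0" "0 \<le> \<phi> v (- b)" using \<phi>_le[of 0 b v] \<phi>_le[of "- b" 0 v] b by auto
    moreover have "continuous_on {-b..b} (\<phi> v)"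
      unfolding \<phi>_def by (intro continuous_intros)
    ultimately show ?thesis using IVT2'[of "\<phi> v" b 0 "- b"] b(1) by auto
  qed
  then obtain s where s: "\<And>v. v \<in> F \<Longrightarrow> \<phi> v (s v) = 0" by metis
  \<comment> \<open>The bisector of \<open>v\<close> is the first one crossed as \<open>s\<close>
    grows; transversality makes the others strictly uncrossed at \<open>s v\<close>.\<close>
  obtain v where v: "v \<in> F" "\<And>w. w \<in> F \<Longrightarrow> s v \<le> s w"
    using ex_is_arg_min_if_finite[OF finF ne, of s] by (auto simp: is_arg_min_linorder)
  define z where "z = h + s v *\<^sub>R y"
  have pos: "0 < \<phi> w (s v)" if w: "w \<in> F - {v}" for w
  proof -
    have "0 \<le> \<phi> w (s v)" using s[of w] \<phi>_less[of "s v" "s w" w] v(2)[of w] w by fastforce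
    moreover have "\<phi> w (s v) \<noteq> 0" using h s[OF v(1)] w v(1) unfolding transversal_def \<phi>_def by fastforce
    ultimately show ?thesis by simp
  qed
  \<comment> \<open>Shifting the direction by \<open>t y\<close> with
    \<open>\<bar>t\<bar> \<le> \<delta>\<close> changes each of the two norms by at most
    \<open>\<delta> * N y\<close> per unit of \<open>\<tau>\<close>; the slack of the other active
    vectors must exceed both changes together.\<close>
  have "\<forall>\<^sub>F \<delta> in at_right 0. \<forall>w\<in>F - {v}. 2 * \<delta> * N y < \<phi> w (s v)"
  proof (intro eventually_ball_finite ballI)
    fix w assume "w \<in> F - {v}"
    moreover have "((\<lambda>\<delta>. 2 * \<delta> * N y) \<longlongrightarrow> 2 * 0 * N y) (at_right 0)" by (intro tendsto_intros)
    ultimately show "\<forall>\<^sub>F \<delta> in at_right 0. 2 * \<delta> * N y < \<phi> w (s v)"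
      using pos by (intro order_tendstoD(2)) auto
  qed (use finF in simp)
  then obtain b where b: "0 < b"
    "\<And>\<delta>. 0 < \<delta> \<Longrightarrow> \<delta> < b \<Longrightarrow> \<forall>w\<in>F - {v}. 2 * \<delta> * N y < \<phi> w (s v)"
    unfolding eventually_at_right_field by blast
  define \<delta> where "\<delta> = b / 2"
  have \<delta>: "0 < \<delta>" "\<And>w. w \<in> F - {v} \<Longrightarrow> 2 * \<delta> * N y < \<phi> w (s v)"
    using b(1) b(2)[of \<delta>] by (simp_all add: \<delta>_def)
  have quot: "((\<lambda>\<tau>. (N (y - w + \<tau> *\<^sub>R x) - N (y + \<tau> *\<^sub>R x)) / \<tau>) \<longlongrightarrow>
      dirderiv (y - w) x - dirderiv y x) (at_right 0)" if "w \<in> F" for w x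
  proof -
    have "((\<lambda>\<tau>. (N (y - w + \<tau> *\<^sub>R x) - N (y - w)) / \<tau> - (N (y + \<tau> *\<^sub>R x) - N y) / \<tau>) \<longlongrightarrow>
      dirderiv (y - w) x - dirderiv y x) (at_right 0)"
      by (intro tendsto_diff dirderiv_tendsto)
    then show ?thesis using that by (simp add: F_def diff_divide_distrib)
  qed
  have zs: "dirderiv (y - w) (z + t *\<^sub>R y) - dirderiv y (z + t *\<^sub>R y) = \<phi> w (s v + t)" for w t
    by (simp add: \<phi>_def z_def algebra_simps)
  have ev1: "\<forall>\<^sub>F \<tau> in at_right 0. \<forall>w\<in>F - {v}.
      2 * \<delta> * N y < (N (y - w + \<tau> *\<^sub>R z) - N (y + \<tau> *\<^sub>R z)) / \<tau>"
  proof (intro eventually_ball_finite ballI)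
    fix w assume w: "w \<in> F - {v}"
    then show "\<forall>\<^sub>F \<tau> in at_right 0. 2 * \<delta> * N y < (N (y - w + \<tau> *\<^sub>R z) - N (y + \<tau> *\<^sub>R z)) / \<tau>"
      using order_tendstoD(1)[OF quot[of w z]] \<delta>(2)[OF w] zs[of w 0] by auto
  qed (use finF in simp)
  have ev2: "\<forall>\<^sub>F \<tau> in at_right 0.
      (N (y - v + \<tau> *\<^sub>R (z + \<delta> *\<^sub>R y)) - N (y + \<tau> *\<^sub>R (z + \<delta> *\<^sub>R y))) / \<tau> < 0"
    using order_tendstoD(2)[OF quot[OF v(1), of "z + \<delta> *\<^sub>R y"]] zs[of v \<delta>]
      \<phi>_less[of "s v" "s v + \<delta>" v] s v(1) \<delta>(1) by auto
  have ev3: "\<forall>\<^sub>F \<tau> in at_right 0.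
      0 < (N (y - v + \<tau> *\<^sub>R (z + (-\<delta>) *\<^sub>R y)) - N (y + \<tau> *\<^sub>R (z + (-\<delta>) *\<^sub>R y))) / \<tau>"
    using order_tendstoD(1)[OF quot[OF v(1), of "z + (-\<delta>) *\<^sub>R y"]] zs[of v "-\<delta>"]
      \<phi>_less[of "s v + (-\<delta>)" "s v" v] s v(1) \<delta>(1) by auto
  \<comment> \<open>These are the inactive nonzero vectors that are not too long. Their inequalities
    are strict at \<open>y\<close>, and there are finitely many, so they stay strict nearby; longer
    vectors are excluded by the triangle inequality.\<close>
  define B where "B = {w \<in> L. N w \<le> 2 * (N y + 1)} - {0} - F"
  have "\<forall>\<^sub>F p in nhds y. N p < N y + 1 \<and> (\<forall>w\<in>B. N p < N (p - w))"
  proof (intro eventually_conj eventually_ball_finite ballI)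
    show "\<forall>\<^sub>F p in nhds y. N p < N y + 1"
      using order_tendstoD(2)[OF tendsto_N[OF tendsto_ident_at[of y UNIV]], of "N y + 1"]
      by (simp add: eventually_nhds_conv_at)
    show "finite B" unfolding B_def using fin by auto
    fix w assume w: "w \<in> B"
    then have "N y < N (y - w)"
      using y(1) unfolding B_def F_def voronoi_cell_def by force
    then have "\<forall>\<^sub>F p in at y. 0 < N (p - w) - N p"
      by (intro order_tendstoD(1)[where y = "N (y - w) - N y"] tendsto_intros) simp
    then show "\<forall>\<^sub>F p in nhds y. N p < N (p - w)"
      using \<open>N y < N (y - w)\<close> by (simp add: eventually_nhds_conv_at)
  qed
  then obtain e where e: "0 < e"
    "\<And>p w. dist p y < e \<Longrightarrow> N p < N y + 1 \<and> (\<forall>w\<in>B. N p < N (p - w))"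
    unfolding eventually_nhds_metric by metis
  have ev4: "\<forall>\<^sub>F \<tau> in at_right 0. \<tau> * (norm z + \<delta> * norm y) < e"
  proof (rule order_tendstoD(2))
    show "((\<lambda>\<tau>. \<tau> * (norm z + \<delta> * norm y)) \<longlongrightarrow> 0 * (norm z + \<delta> * norm y)) (at_right 0)"
      by (intro tendsto_intros)
  qed (use e in simp)
  have "\<forall>\<^sub>F \<tau> in at_right (0::real). 0 < \<tau>" by (simp add: eventually_at_right_less)
  with ev1 ev2 ev3 ev4 have "\<forall>\<^sub>F \<tau> in at_right 0. 0 < \<tau> \<and> \<tau> * (norm z + \<delta> * norm y) < e \<and>
      0 < (N (y - v + \<tau> *\<^sub>R (z + (-\<delta>) *\<^sub>R y)) - N (y + \<tau> *\<^sub>R (z + (-\<delta>) *\<^sub>R y))) / \<tau> \<and>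
      (N (y - v + \<tau> *\<^sub>R (z + \<delta> *\<^sub>R y)) - N (y + \<tau> *\<^sub>R (z + \<delta> *\<^sub>R y))) / \<tau> < 0 \<and>
      (\<forall>w\<in>F - {v}. 2 * \<delta> * N y < (N (y - w + \<tau> *\<^sub>R z) - N (y + \<tau> *\<^sub>R z)) / \<tau>)"
    by (intro eventually_conj)
  from eventually_happens'[OF trivial_limit_at_right_real this] obtain \<tau> where \<tau>: "0 < \<tau>"
    "\<tau> * (norm z + \<delta> * norm y) < e"
    "0 < (N (y - v + \<tau> *\<^sub>R (z + (-\<delta>) *\<^sub>R y)) - N (y + \<tau> *\<^sub>R (z + (-\<delta>) *\<^sub>R y))) / \<tau>"
    "(N (y - v + \<tau> *\<^sub>R (z + \<delta> *\<^sub>R y)) - N (y + \<tau> *\<^sub>R (z + \<delta> *\<^sub>R y))) / \<tau> < 0"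
    "\<And>w. w \<in> F - {v} \<Longrightarrow> 2 * \<delta> * N y < (N (y - w + \<tau> *\<^sub>R z) - N (y + \<tau> *\<^sub>R z)) / \<tau>"
    by blast
  \<comment> \<open>The true bisector of \<open>v\<close> is crossed between
    \<open>t = -\<delta>\<close> and \<open>t = \<delta>\<close>; a zero of \<open>f\<close> yields
    the point \<open>p\<close> witnessing relevance.\<close>
  define f where "f t = N (y - v + \<tau> *\<^sub>R (z + t *\<^sub>R y)) - N (y + \<tau> *\<^sub>R (z + t *\<^sub>R y))" for t
  have "f \<delta> \<le> 0" "0 \<le> f (- \<delta>)"
    using \<tau>(1,3,4) by (auto simp: f_def zero_less_divide_iff divide_less_0_iff)
  moreover have "continuous_on {-\<delta>..\<delta>} f" unfolding f_def by (intro continuous_intros)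
  ultimately obtain t where t: "-\<delta> \<le> t" "t \<le> \<delta>" "f t = 0"
    using IVT2'[of f \<delta> 0 "-\<delta>"] \<delta>(1) by auto
  define p where "p = y + \<tau> *\<^sub>R (z + t *\<^sub>R y)"
  have pv: "N p = N (p - v)" using t(3) by (simp add: f_def p_def algebra_simps)
  have F_less: "N p < N (p - w)" if w: "w \<in> F - {v}" for w
  proof -
    have ty: "N ((\<tau> * t) *\<^sub>R y) \<le> \<tau> * \<delta> * N y"
      using t(1,2) \<tau>(1) by (auto simp: N_scaleR abs_mult intro!: mult_mono)
    have "N p \<le> N (y + \<tau> *\<^sub>R z) + \<tau> * \<delta> * N y"
      using N_triangle[of "y + \<tau> *\<^sub>R z" "(\<tau> * t) *\<^sub>R y"] ty
      by (simp add: p_def algebra_simps)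
    moreover have "N (y - w + \<tau> *\<^sub>R z) \<le> N (p - w) + \<tau> * \<delta> * N y"
      using N_diff_le[of "y - w + \<tau> *\<^sub>R z" "p - w"] ty N_minus[of "(\<tau> * t) *\<^sub>R y"]
      by (simp add: p_def algebra_simps)
    moreover have "2 * (\<tau> * \<delta> * N y) < N (y - w + \<tau> *\<^sub>R z) - N (y + \<tau> *\<^sub>R z)"
      using \<tau>(5)[OF w] \<tau>(1) by (simp add: field_simps)
    ultimately show ?thesis by linarith
  qed
  have "\<bar>t\<bar> * norm y \<le> \<delta> * norm y" using t(1,2) by (intro mult_right_mono) auto
  then have "norm (z + t *\<^sub>R y) \<le> norm z + \<delta> * norm y"
    using norm_triangle_ineq[of z "t *\<^sub>R y"] by simp
  then have "dist p y < e"
    using le_less_trans[OF mult_left_mono[of "norm (z + t *\<^sub>R y)" "norm z + \<delta> * norm y" \<tau>] \<tau>(2)] \<tau>(1)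
    by (simp add: p_def dist_norm)
  then have pe: "N p < N y + 1" "\<And>w. w \<in> B \<Longrightarrow> N p < N (p - w)" using e(2) by auto
  have "N (p - v) < N (p - w)" if w: "w \<in> L - {0, v}" for w
  proof (cases "w \<in> F \<or> w \<in> B")
    case True
    then show ?thesis using F_less[of w] pe(2) w pv by auto
  next
    case False
    then have "2 * (N y + 1) < N w" using w by (auto simp: B_def)
    then show ?thesis using N_diff_le[of w p] N_minus_commute[of w p] pe(1) pv by simp
  qed
  then show ?thesis using v(1) pv unfolding voronoi_relevant_def F_def by blast
qed

section \<open>Existence of transversal directions\<close>

text \<open>Unique subgradients make the derivatives linear, so each pair of bisectors excludes one
  hyperplane of directions; finitely many hyperplanes form a negligible set.\<close>

lemma transversal_exists_smooth:
  assumes smooth: "smooth_norm N" and "finite F" "y \<noteq> 0"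
    and F: "\<And>v. v \<in> F \<Longrightarrow> v \<noteq> 0 \<and> N (y - v) = N y"
  shows "\<exists>h. transversal y F h"
proof -
  obtain G where G: "\<And>p. subgrad p (G p)" using subgrad_exists by metis
  have D: "dirderiv p x = G p \<bullet> x" if "p \<noteq> 0" for p x
    using dirderiv_attained[of p x] smooth_subgrad_unique[OF smooth that G] by metis
  have F0: "y - v \<noteq> 0" if "v \<in> F" for v
    using F[OF that] N_pos[OF \<open>y \<noteq> 0\<close>] by (metis N_eq_0_iff less_irrefl)
  define d where "d v = G (y - v) - G y" for v
  \<comment> \<open>This combination of \<open>d v\<close> and \<open>d w\<close> is orthogonal to
    \<open>y\<close>, which removes the unknown \<open>s\<close> from the condition on
    \<open>h\<close>.\<close>
  define n where "n v w = (d w \<bullet> y) *\<^sub>R d v - (d v \<bullet> y) *\<^sub>R d w" for v w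
  have n: "n v w \<noteq> 0" if "v \<in> F" "w \<in> F" "v \<noteq> w" for v w
  proof
    assume "n v w = 0"
    then have eq: "(d w \<bullet> y) *\<^sub>R d v = (d v \<bullet> y) *\<^sub>R d w" by (simp add: n_def)
    have "d w \<bullet> y \<noteq> 0"
      using subgrad_less[OF G[of "y - w"], of y] subgrad_eq[OF G[of y]] F[OF that(2)]
      by (auto simp: d_def inner_diff_left)
    then have "d v = ((d v \<bullet> y) / (d w \<bullet> y)) *\<^sub>R d w"
      using arg_cong[OF eq, of "\<lambda>x. (1 / (d w \<bullet> y)) *\<^sub>R x"] by simp
    then show False
      using subgrad_not_collinear[OF G[of y] G[of "y - v"] G[of "y - w"]] F that
      unfolding d_def by auto
  qed
  define P where "P = {p \<in> F \<times> F. fst p \<noteq> snd p}"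
  have "negligible (\<Union> ((\<lambda>p. {x. n (fst p) (snd p) \<bullet> x = 0}) ` P))"
  proof (rule negligible_Union)
    show "finite ((\<lambda>p. {x. n (fst p) (snd p) \<bullet> x = 0}) ` P)"
      unfolding P_def using \<open>finite F\<close> by simp
    fix S assume "S \<in> (\<lambda>p. {x. n (fst p) (snd p) \<bullet> x = 0}) ` P"
    then obtain p where "p \<in> P" "S = {x. n (fst p) (snd p) \<bullet> x = 0}" by blast
    then show "negligible S" using n[of "fst p" "snd p"] by (auto simp: P_def intro!: negligible_hyperplane)
  qed
  then have "\<Union> ((\<lambda>p. {x. n (fst p) (snd p) \<bullet> x = 0}) ` P) \<noteq> UNIV"
    using non_negligible_UNIV by metis
  then obtain h where "\<forall>p\<in>P. n (fst p) (snd p) \<bullet> h \<noteq> 0" by blast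
  then have h: "n v w \<bullet> h \<noteq> 0" if "v \<in> F" "w \<in> F" "v \<noteq> w" for v w
    using that by (force simp: P_def)
  have False if vw: "v \<in> F" "w \<in> F" "v \<noteq> w"
    and "dirderiv (y - v) (h + s *\<^sub>R y) = dirderiv y (h + s *\<^sub>R y)"
    and "dirderiv (y - w) (h + s *\<^sub>R y) = dirderiv y (h + s *\<^sub>R y)" for v w s
  proof -
    have "d v \<bullet> (h + s *\<^sub>R y) = 0" "d w \<bullet> (h + s *\<^sub>R y) = 0"
      using that(4,5) D[OF F0[OF vw(1)]] D[OF F0[OF vw(2)]] D[OF \<open>y \<noteq> 0\<close>]
      by (simp_all add: d_def inner_diff_left)
    then have "n v w \<bullet> (h + s *\<^sub>R y) = 0" by (simp add: n_def inner_diff_left)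
    moreover have "n v w \<bullet> y = 0" by (simp add: n_def inner_diff_left)
    ultimately have "n v w \<bullet> h = 0" by (simp add: inner_add_right)
    then show False using h[OF vw] by simp
  qed
  then show ?thesis unfolding transversal_def by blast
qed

text \<open>Subgradients are chosen to attain the derivatives in the offending direction itself.
  Equal derivatives then make their differences orthogonal to it, although the derivatives need not
  be linear.\<close>

lemma transversal_exists_planar:
  assumes card: "CARD('n) = 2" and F: "\<And>v. v \<in> F \<Longrightarrow> v \<noteq> 0 \<and> N (y - v) = N y"
  shows "\<exists>h. transversal y F h"
proof -
  have "span {y} \<noteq> UNIV"
  proof
    assume "span {y} = UNIV"
    then have "dim (UNIV :: (real ^ 'n) set) \<le> card {y}"
      using dim_le_card[of UNIV "{y}"] by simp
    then show False using card by simp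
  qed
  then obtain h where h: "h \<notin> span {y}" by blast
  have False if vw: "v \<in> F" "w \<in> F" "v \<noteq> w"
    and eq: "dirderiv (y - v) (h + s *\<^sub>R y) = dirderiv y (h + s *\<^sub>R y)"
      "dirderiv (y - w) (h + s *\<^sub>R y) = dirderiv y (h + s *\<^sub>R y)" for v w s
  proof -
    let ?z = "h + s *\<^sub>R y"
    have z: "?z \<noteq> 0"
    proof
      assume "?z = 0"
      then have "h = (- s) *\<^sub>R y" by (simp add: eq_neg_iff_add_eq_0)
      then show False using h by (metis span_mul span_base singletonI)
    qed
    obtain g where g: "subgrad y g" "g \<bullet> ?z = dirderiv y ?z" by (rule dirderiv_attained)
    obtain gv where gv: "subgrad (y - v) gv" "gv \<bullet> ?z = dirderiv (y - v) ?z"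
      by (rule dirderiv_attained)
    obtain gw where gw: "subgrad (y - w) gw" "gw \<bullet> ?z = dirderiv (y - w) ?z"
      by (rule dirderiv_attained)
    have nc: "gv - g \<noteq> c *\<^sub>R (gw - g)" for c
      using subgrad_not_collinear[OF g(1) gv(1) gw(1)] F vw by auto
    have nc': "gw - g \<noteq> c *\<^sub>R (gv - g)" for c
      using subgrad_not_collinear[OF g(1) gw(1) gv(1)] F vw by auto
    have "independent {gv - g, gw - g}"
      using nc nc'[of 0] by (auto simp: independent_insert span_singleton)
    moreover have "gv - g \<noteq> gw - g" using nc[of 1] by simp
    ultimately have "UNIV \<subseteq> span {gv - g, gw - g}"
      using card by (intro card_ge_dim_independent) auto
    moreover have "subspace {x. x \<bullet> ?z = 0}"
      by (auto simp: subspace_def inner_add_left)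
    moreover have "{gv - g, gw - g} \<subseteq> {x. x \<bullet> ?z = 0}"
      using g(2) gv(2) gw(2) eq by (simp add: inner_diff_left)
    ultimately have "?z \<bullet> ?z = 0" using span_minimal by blast
    then show False using z by simp
  qed
  then show ?thesis unfolding transversal_def by blast
qed

section \<open>From a violated inequality to a violated relevant one\<close>

text \<open>Every inequality violated at \<open>x\<close> becomes an equality somewhere on the
  segment from 0 to \<open>x\<close>. At the equality point nearest to 0 all inequalities hold, by
  star-shapedness.\<close>

lemma voronoi_cell_boundary_on_segment:
  assumes fin: "\<And>c. finite {v \<in> L. N v \<le> c}" and x: "x \<notin> voronoi_cell L N"
  obtains t v where "0 < t" "t < 1" "t *\<^sub>R x \<in> voronoi_cell L N" "v \<in> L - {0}"
    "N (t *\<^sub>R x - v) = N (t *\<^sub>R x)"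
proof -
  define W where "W = {v \<in> L. N (x - v) < N x}"
  have "finite W"
    by (rule finite_subset[OF _ finite_closer[OF fin, of x]]) (auto simp: W_def)
  have "W \<noteq> {}" using x by (auto simp: W_def voronoi_cell_def not_le)
  have W0: "v \<noteq> 0" if "v \<in> W" for v using that by (auto simp: W_def)
  have "\<exists>t. 0 < t \<and> t < 1 \<and> N (t *\<^sub>R x - v) = N (t *\<^sub>R x)" if v: "v \<in> W" for v
  proof -
    define f where "f t = N (t *\<^sub>R x - v) - N (t *\<^sub>R x)" for t
    have f: "0 < f 0" "f 1 < 0" using v N_pos[OF W0[OF v]] by (auto simp: f_def W_def N_minus)
    moreover have "continuous_on {0..1} f" unfolding f_def by (intro continuous_intros)
    ultimately obtain t where "0 \<le> t" "t \<le> 1" "f t = 0"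
      using IVT2'[of f 1 0 0] by auto
    then show ?thesis using f by (intro exI[of _ t]) (auto simp: f_def less_le)
  qed
  then obtain T where T: "\<And>v. v \<in> W \<Longrightarrow> 0 < T v \<and> T v < 1 \<and> N (T v *\<^sub>R x - v) = N (T v *\<^sub>R x)"
    by metis
  obtain v where v: "v \<in> W" "\<And>w. w \<in> W \<Longrightarrow> T v \<le> T w"
    using ex_is_arg_min_if_finite[OF \<open>finite W\<close> \<open>W \<noteq> {}\<close>, of T] by (auto simp: is_arg_min_linorder)
  have "N (T v *\<^sub>R x) \<le> N (T v *\<^sub>R x - w)" if w: "w \<in> L" for w
  proof (cases "w \<in> W")
    case True
    \<comment> \<open>If the crossing for \<open>w\<close> comes later, star-shapedness is used from
      the point \<open>T w *\<^sub>R x\<close>, scaled down by \<open>T v / T w\<close>.\<close>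
    have "T v = T w \<or> T v / T w < 1" using v(2)[OF True] T[OF True] by auto
    then show ?thesis
    proof
      assume "T v / T w < 1"
      then show ?thesis
        using bisector_star[of "T w *\<^sub>R x" w "T v / T w"] T[OF True] T[OF v(1)] W0[OF True] by simp
    qed (use T[OF True] in simp)
  next
    case False
    then show ?thesis
      using bisector_star[of x w "T v"] T[OF v(1)] w by (cases "w = 0") (auto simp: W_def)
  qed
  then show thesis
    using that[of "T v" v] T[OF v(1)] v(1) W0[OF v(1)] by (auto simp: voronoi_cell_def W_def)
qed

text \<open>The smooth and the planar case share this argument; they differ only in how
  \<open>trans\<close> is established.\<close>

lemma voronoi_cell_eq_relevant:
  assumes fin: "\<And>c. finite {v \<in> L. N v \<le> c}"
    and trans: "\<And>y F. finite F \<Longrightarrow> y \<noteq> 0 \<Longrightarrow> (\<And>v. v \<in> F \<Longrightarrow> v \<noteq> 0 \<and> N (y - v) = N y) \<Longrightarrow>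
      \<exists>h. transversal y F h"
  shows "voronoi_cell L N = relevant_voronoi_cell L N"
proof
  show "voronoi_cell L N \<subseteq> relevant_voronoi_cell L N"
    by (auto simp: voronoi_cell_def relevant_voronoi_cell_def)
  show "relevant_voronoi_cell L N \<subseteq> voronoi_cell L N"
  proof (rule subsetI, rule ccontr)
    fix x assume x: "x \<in> relevant_voronoi_cell L N" "x \<notin> voronoi_cell L N"
    obtain t u where t: "0 < t" "t < 1" "t *\<^sub>R x \<in> voronoi_cell L N"
      and u: "u \<in> L - {0}" "N (t *\<^sub>R x - u) = N (t *\<^sub>R x)"
      using voronoi_cell_boundary_on_segment[OF fin x(2)] by metis
    define y where "y = t *\<^sub>R x"
    define F where "F = {v \<in> L - {0}. N (y - v) = N y}"
    have "y \<noteq> 0" using u by (auto simp: y_def)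
    have "finite F"
      by (rule finite_subset[OF _ finite_closer[OF fin, of y]]) (auto simp: F_def)
    moreover have "v \<noteq> 0 \<and> N (y - v) = N y" if "v \<in> F" for v using that by (simp add: F_def)
    ultimately obtain h where h: "transversal y F h" using trans[of F y] \<open>y \<noteq> 0\<close> by blast
    have "u \<in> F" using u by (simp add: F_def y_def)
    then have "\<exists>v\<in>F. voronoi_relevant L N v"
      using voronoi_relevant_exists[OF fin, of y h] t(3) \<open>y \<noteq> 0\<close> h
      unfolding y_def[symmetric] F_def[symmetric] by blast
    then obtain v where v: "v \<in> F" "voronoi_relevant L N v" by blast
    then have "N x \<le> N (x - v)" using x(1) by (auto simp: relevant_voronoi_cell_def F_def)
    \<comment> \<open>The relevant inequality at \<open>x\<close> becomes strict at
      \<open>y\<close>, nearer to 0, whereas \<open>v\<close> is active at \<open>y\<close>.\<close>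
    then have "N y < N (y - v)"
      using bisector_star[of x v t] t v(1) by (auto simp: y_def F_def)
    then show False using v(1) by (simp add: F_def)
  qed
qed

end

theorem theorem2:
  fixes L :: "(real ^ 'n) set" and N :: "real ^ 'n \<Rightarrow> real"
  assumes "full_rank_lattice L" and "strictly_convex_norm N"
  shows "(smooth_norm N \<longrightarrow> voronoi_cell L N = relevant_voronoi_cell L N) \<and>
         (CARD('n) = 2 \<longrightarrow> voronoi_cell L N = relevant_voronoi_cell L N)"
proof -
  interpret strict_norm_space N
    using assms(2) by unfold_locales (auto simp: strictly_convex_norm_def)
  note eq = voronoi_cell_eq_relevant[OF finite_lattice_ball[OF assms(1)]]
  show ?thesis
  proof (intro conjI impI)
    assume "smooth_norm N"
    then show "voronoi_cell L N = relevant_voronoi_cell L N"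
      by (intro eq transversal_exists_smooth)
  next
    assume "CARD('n) = 2"
    then show "voronoi_cell L N = relevant_voronoi_cell L N"
      by (intro eq transversal_exists_planar)
  qed
qed

end
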